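(* Let $P\in\mathbb{Q}[x,y]$ be irreducible and let $\mathcal{C}=\{(x,y)\in\mathbb{C}^2 : P(x,y)=0\}$ be a polynomial curve with polynomial parametrisation $(p(t),q(t))$, $p,q\in\mathbb{Q}[t]$. Suppose $\deg P = \max(\deg p,\deg q) = \deg p = d$, and write $p(t)=\frac1b(a_dt^d+\cdots+a_0)$ with $a_0,\ldots,a_d,b\in\mathbb{Z}$, $\gcd(a_0,\ldots,a_d,b)=1$, $a_d>0$, $b>0$. Then for all $\epsilon>0$ there exists $B_0>0$ such that for all $B\geq B_0$, $$N(\mathcal{C},B) \leq 2\,a_d^{1-\frac1d}\,b^{\frac1d}\,B^{\frac1d} + \frac{(d-1)(d-2)}{2} + 1 + \epsilon.$$
   Context: The curve $\mathcal{C}$ is a polynomial curve if it admits a polynomial parametrisation $(p(t),q(t))$ with $p(t),q(t)\in\mathbb{Q}[t]$ (equivalently, $\mathcal{C}$ is a rational curve with one place at infinity); a parametrisation means a birational map onto $\mathcal{C}$, and then $\deg P=\max(\deg p,\deg q)$. For a curve $\mathcal{C}\subset\mathbb{C}^2$ and $B>0$, $$N(\mathcal{C},B) = \#\{(x,y)\in\mathcal{C}\cap\mathbb{Z}^2 : |x|\leq B \text{ and } |y|\leq B\}.$$ *)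

theory Defs
  imports Complex_Main "HOL-Computational_Algebra.Computational_Algebra"
begin

text \<open>
  A bivariate polynomial is an element of \<open>K[x][y]\<close>, i.e. of type \<open>'a poly poly\<close>:
  \<open>coeff (coeff P j) i\<close> is the coefficient of \<open>x^i * y^j\<close>.
\<close>

definition poly2 :: "'a::comm_semiring_0 poly poly \<Rightarrow> 'a \<Rightarrow> 'a \<Rightarrow> 'a" where
  "poly2 P x y = poly (poly P [:y:]) x"

lemma poly2_eq_sum:
  fixes P :: "'a::comm_ring_1 poly poly"
  shows "poly2 P x y = (\<Sum>j\<le>degree P. \<Sum>i\<le>degree (coeff P j). coeff (coeff P j) i * x ^ i * y ^ j)"
  by (simp add: poly2_def poly_altdef[of P] poly_sum poly_altdef[of "coeff P _"]
      sum_distrib_right poly_power)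

text \<open>The zero polynomial gets an unspecified value.\<close>

definition total_degree :: "'a::zero poly poly \<Rightarrow> nat" where
  "total_degree P = Max {i + j |i j. coeff (coeff P j) i \<noteq> 0}"

definition plane_curve :: "rat poly poly \<Rightarrow> (complex \<times> complex) set" where
  "plane_curve P = {(x, y). poly2 (map_poly (map_poly of_rat) P) x y = 0}"

definition param_map :: "rat poly \<Rightarrow> rat poly \<Rightarrow> complex \<Rightarrow> complex \<times> complex" where
  "param_map p q t = (poly (map_poly of_rat p) t, poly (map_poly of_rat q) t)"

definition rat_fun2 :: "complex poly poly \<Rightarrow> complex poly poly \<Rightarrow> complex \<times> complex \<Rightarrow> complex" where
  "rat_fun2 G H z = poly2 G (fst z) (snd z) / poly2 H (fst z) (snd z)"

text \<open>
  The map \<open>t \<mapsto> (p t, q t)\<close> sends the affine line into the curve \<open>C\<close> and has a rational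
  inverse \<open>G / H\<close>.  Dense Zariski-open subsets of a curve are the cofinite ones (up to isolated
  points, which a plane curve over the complex numbers does not have), so the conditions on \<open>H\<close>
  say that \<open>G / H\<close> is defined on a dense open subset of \<open>C\<close> and that its composition with the
  parametrisation is defined on a dense open subset of the line; the two compositions are
  the identity wherever they are defined.
\<close>

definition polynomial_parametrisation ::
    "rat poly \<Rightarrow> rat poly \<Rightarrow> (complex \<times> complex) set \<Rightarrow> bool" where
  "polynomial_parametrisation p q C \<longleftrightarrow>
     range (param_map p q) \<subseteq> C \<and>
     (\<exists>G H :: complex poly poly.
        finite {z \<in> C. poly2 H (fst z) (snd z) = 0} \<and>
        finite {t. poly2 H (fst (param_map p q t)) (snd (param_map p q t)) = 0} \<and>
        (\<forall>t. poly2 H (fst (param_map p q t)) (snd (param_map p q t)) \<noteq> 0 \<longrightarrow>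
             rat_fun2 G H (param_map p q t) = t) \<and>
        (\<forall>z\<in>C. poly2 H (fst z) (snd z) \<noteq> 0 \<longrightarrow> param_map p q (rat_fun2 G H z) = z))"

text \<open>
  The bound \<open>B\<close> is real, and integer points are regarded as points of the complex plane curve.
\<close>

definition num_integer_points :: "(complex \<times> complex) set \<Rightarrow> real \<Rightarrow> nat" where
  "num_integer_points C B =
     card {(x :: int, y :: int). (of_int x, of_int y) \<in> C \<and>
             \<bar>real_of_int x\<bar> \<le> B \<and> \<bar>real_of_int y\<bar> \<le> B}"

end

theory Submission
  imports Defs "Subresultants.Subresultant_Gcd" "HOL-Computational_Algebra.Field_as_Ring"
begin

text \<open>
  Since \<open>P\<close> has total degree \<open>d = deg p\<close>, it has \<open>d\<close> zeros over a general abscissa, namely the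
  images of the \<open>d\<close> solutions of \<open>p(t) = x\<close>, and a constant leading coefficient in \<open>y\<close>; hence
  every point of the curve is \<open>(p(t), q(t))\<close> for some complex \<open>t\<close>.  An integer point with rational
  \<open>t\<close> has \<open>t = k / a_d\<close> for an integer \<open>k\<close>, and \<open>|p(t)| \<le> B\<close> confines \<open>t\<close> to an interval of
  length \<open>2 (b B / a_d)^(1/d) + o(1)\<close>.  An integer point without a rational parameter has at least
  two complex ones, because a gcd of \<open>p - x\<close> and \<open>q - y\<close> with a single root has a rational root.
  The parameters sharing their image with another parameter are zeros of the resultant in \<open>s\<close> of
  \<open>(p(s) - p(t)) / (s - t)\<close> and \<open>(q(s) - q(t)) / (s - t)\<close>, of degree at most \<open>(d - 1) (d - 2)\<close>
  in \<open>t\<close> once \<open>deg q < d\<close>.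
\<close>

text \<open>Otherwise \<open>smult\<close> on polynomials would be ambiguous.\<close>

hide_const (open) Module.smult

section \<open>Degree of a resultant with graded coefficients\<close>

text \<open>Each entry of the Sylvester matrix has degree at most its column index minus the shift
  of its row. Along any permutation these bounds add up to the same number, so every term of the
  Leibniz expansion obeys it.\<close>

lemma degree_resultant_le:
  fixes f g :: "'a::comm_ring_1 poly poly"
  assumes f: "\<And>k. degree (coeff f k) \<le> degree f - k"
    and g: "\<And>k. degree (coeff g k) \<le> degree g - k"
  shows "degree (resultant f g) \<le> degree f * degree g"
proof -
  define m n where "m = degree f" and "n = degree g"
  define S where "S = sylvester_mat f g"
  \<comment> \<open>Row \<open>i\<close> holds \<open>f\<close> shifted by \<open>i\<close> when
    \<open>i < n\<close>, and \<open>g\<close> shifted by \<open>i - n\<close> otherwise;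
    \<open>w i\<close> is this shift. Column indices and shifts differ in total by
    \<open>m * n\<close>.\<close>
  define w where "w i = (if i < n then i else i - n)" for i
  have S: "S \<in> carrier_mat (m + n) (m + n)"
    unfolding S_def m_def n_def by (rule sylvester_carrier_mat)
  have entry: "degree (S $$ (i, j)) + w i \<le> j"
    if "i < m + n" "j < m + n" "S $$ (i, j) \<noteq> 0" for i j
    using that f[of "m + i - j"] g[of "i - j"]
    unfolding S_def w_def
    by (auto simp: sylvester_index_mat m_def n_def split: if_splits)
  have "(\<Sum>i<m + k. i) = (\<Sum>i<m. i) + (\<Sum>i<k. i) + m * k" for k
    by (induction k) auto
  moreover have "(\<Sum>i<n + k. w i) = (\<Sum>i<n. i) + (\<Sum>i<k. i)" for k
    by (induction k) (auto simp: w_def)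
  ultimately have weights: "(\<Sum>i<m + n. i) = (\<Sum>i<m + n. w i) + m * n"
    by (metis add.commute)
  have "degree (of_int (sign \<sigma>) * (\<Prod>i = 0..<m + n. S $$ (i, \<sigma> i))) \<le> m * n"
    if \<sigma>: "\<sigma> permutes {0..<m + n}" for \<sigma>
  \<comment> \<open>A zero entry has degree 0 by convention and may violate \<open>entry\<close>,
    but it makes the whole product vanish.\<close>
  proof (cases "\<exists>i<m + n. S $$ (i, \<sigma> i) = 0")
    case True
    then have "(\<Prod>i = 0..<m + n. S $$ (i, \<sigma> i)) = 0"
      by (auto intro!: prod_zero)
    then show ?thesis by simp
  next
    case False
    have "degree (of_int (sign \<sigma>) * (\<Prod>i = 0..<m + n. S $$ (i, \<sigma> i)))
        \<le> degree (\<Prod>i = 0..<m + n. S $$ (i, \<sigma> i))"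
      using degree_mult_le[of "of_int (sign \<sigma>)" "\<Prod>i = 0..<m + n. S $$ (i, \<sigma> i)"] by simp
    also have "\<dots> \<le> (\<Sum>i = 0..<m + n. degree (S $$ (i, \<sigma> i)))"
      using degree_prod_sum_le[of "{0..<m + n}" "\<lambda>i. S $$ (i, \<sigma> i)"] by (simp add: o_def)
    finally have 1: "degree (of_int (sign \<sigma>) * (\<Prod>i = 0..<m + n. S $$ (i, \<sigma> i)))
      \<le> (\<Sum>i = 0..<m + n. degree (S $$ (i, \<sigma> i)))" .
    have "(\<Sum>i = 0..<m + n. degree (S $$ (i, \<sigma> i))) + (\<Sum>i<m + n. w i)
        = (\<Sum>i = 0..<m + n. degree (S $$ (i, \<sigma> i)) + w i)"
      by (simp add: sum.distrib atLeast0LessThan)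
    also have "\<dots> \<le> (\<Sum>i = 0..<m + n. \<sigma> i)"
      using False permutes_in_image[OF \<sigma>] by (intro sum_mono entry) auto
    also have "\<dots> = (\<Sum>i<m + n. i)"
      using sum.permute[OF \<sigma>, of "\<lambda>i. i"] by (simp add: o_def atLeast0LessThan)
    finally show ?thesis using 1 weights by linarith
  qed
  then show ?thesis
    unfolding resultant_def S_def[symmetric] det_def'[OF S] m_def[symmetric] n_def[symmetric]
    by (intro degree_sum_le) (auto simp: finite_permutations)
qed

section \<open>Difference quotients and the number of double parameters\<close>

text \<open>Evaluating the coefficients of \<open>diff_quot p\<close> at \<open>t\<close> gives the polynomial
  \<open>(p s - p t) / (s - t)\<close> in \<open>s\<close>.\<close>

definition diff_quot :: "'a::comm_ring_1 poly \<Rightarrow> 'a poly poly" where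
  "diff_quot p = synthetic_div (map_poly (\<lambda>c. [:c:]) p) [:0, 1:]"

lemma poly_const_map_poly_X: "poly (map_poly (\<lambda>c. [:c:]) p) [:0, 1:] = p"
  for p :: "'a::comm_ring_1 poly"
  by (induction p) (simp_all add: Polynomial.map_poly_pCons)

lemma diff_quot_0 [simp]: "diff_quot 0 = 0"
  by (simp add: diff_quot_def)

lemma diff_quot_pCons [simp]: "diff_quot (pCons a p) = pCons p (diff_quot p)"
  by (simp only: diff_quot_def Polynomial.map_poly_pCons pCons_0_0 synthetic_div_pCons
      poly_const_map_poly_X)

lemma map_poly_diff_quot: "map_poly (\<lambda>c. poly c t) (diff_quot p) = synthetic_div p t"
  by (induction p) (simp_all add: poly_hom.map_poly_pCons_hom)

lemma degree_diff_quot: "degree (diff_quot p) = degree p - 1"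
  by (simp add: diff_quot_def degree_synthetic_div degree_map_poly)

text \<open>In two variables \<open>(p s - p t) / (s - t)\<close> has total degree at most
  \<open>degree p - 1\<close>; this is the grading that \<open>degree_resultant_le\<close> asks
  for.\<close>

lemma degree_coeff_diff_quot: "degree (coeff (diff_quot p) k) \<le> degree (diff_quot p) - k"
proof (induction p arbitrary: k)
  case (pCons a p)
  have "degree (diff_quot (pCons a p)) = degree p"
    by (subst degree_diff_quot) simp
  then show ?case
    using pCons.IH[of "k - 1"] by (cases k) (auto simp: degree_diff_quot)
qed simp

text \<open>Specialising \<open>t\<close> never lowers the degree in \<open>s\<close>, so it
  commutes with forming the resultant.\<close>

lemma poly_resultant_diff_quot:
  fixes p q :: "'a::comm_ring_1 poly"
  shows "poly (resultant (diff_quot p) (diff_quot q)) t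
    = resultant (synthetic_div p t) (synthetic_div q t)"
  using poly_hom.resultant_map_poly[of t "diff_quot p" "diff_quot q"]
  by (simp add: map_poly_diff_quot degree_diff_quot degree_synthetic_div)

lemma poly_eq_synthetic_div: "poly p s = (s - t) * poly (synthetic_div p t) s + poly p t"
  for p :: "'a::comm_ring_1 poly"
  by (subst synthetic_div_correct'[of t p, symmetric]) (simp add: algebra_simps)

lemma poly_synthetic_div_self: "poly (synthetic_div p t) t = poly (pderiv p) t"
  for p :: "'a::idom poly"
proof -
  have "pderiv p = pderiv ([:- t, 1:] * synthetic_div p t + [:poly p t:])"
    by (simp only: synthetic_div_correct')
  also have "poly \<dots> t = poly (synthetic_div p t) t"
    by (simp add: pderiv_mult pderiv_add pderiv_pCons del: mult_pCons_left)
  finally show ?thesis by simp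
qed

text \<open>If \<open>s\<close> and \<open>t\<close> share their image, then \<open>s\<close> is a
  common root of both difference quotients at \<open>t\<close>, so \<open>t\<close> is a root of
  \<open>R\<close>. The point \<open>t0\<close> certifies \<open>R \<noteq> 0\<close>: a common root
  there could only be \<open>t0\<close> itself, where the quotient of \<open>p\<close> takes the
  value \<open>poly (pderiv p) t0\<close>.\<close>

lemma card_double_points_le:
  fixes p q :: "complex poly"
  assumes deg: "degree q < degree p"
    and t0: "poly (pderiv p) t0 \<noteq> 0"
      "\<And>s. poly p s = poly p t0 \<Longrightarrow> poly q s = poly q t0 \<Longrightarrow> s = t0"
  defines "T \<equiv> {t. \<exists>s. s \<noteq> t \<and> poly p s = poly p t \<and> poly q s = poly q t}"
  shows "finite T" and "card T \<le> (degree p - 1) * (degree p - 2)"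
proof -
  define R where "R = resultant (diff_quot p) (diff_quot q)"
  have sd0: "synthetic_div p t \<noteq> 0" for t
    using deg by (simp add: synthetic_div_eq_0_iff)
  have R: "poly R t = 0 \<longleftrightarrow> degree (gcd (synthetic_div p t) (synthetic_div q t)) \<noteq> 0" for t
    unfolding R_def poly_resultant_diff_quot by (rule resultant_0_gcd)
  have "poly R t0 \<noteq> 0"
  proof
    assume "poly R t0 = 0"
    then obtain s where "poly (gcd (synthetic_div p t0) (synthetic_div q t0)) s = 0"
      using alg_closed_imp_poly_has_root R by blast
    then have s: "poly (synthetic_div p t0) s = 0" "poly (synthetic_div q t0) s = 0"
      by (auto simp: poly_eq_0_iff_dvd)
    then have "s = t0"
      using poly_eq_synthetic_div[of p s t0] poly_eq_synthetic_div[of q s t0]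
      by (intro t0(2)) simp_all
    then show False using s(1) t0(1) by (simp add: poly_synthetic_div_self)
  qed
  then have R0: "R \<noteq> 0" by auto
  have "poly R t = 0" if "t \<in> T" for t
  proof -
    obtain s where "s \<noteq> t" "poly p s = poly p t" "poly q s = poly q t"
      using \<open>t \<in> T\<close> by (auto simp: T_def)
    then have "[:- s, 1:] dvd gcd (synthetic_div p t) (synthetic_div q t)"
      using poly_eq_synthetic_div[of p s t] poly_eq_synthetic_div[of q s t]
      by (simp add: poly_eq_0_iff_dvd)
    then have "degree [:- s, 1:] \<le> degree (gcd (synthetic_div p t) (synthetic_div q t))"
      using sd0 by (intro dvd_imp_degree_le) simp_all
    then show ?thesis by (simp add: R)
  qed
  then have sub: "T \<subseteq> {t. poly R t = 0}" by blast
  then show "finite T" using R0 poly_roots_finite finite_subset by blast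
  have "card T \<le> degree R"
    using card_mono[OF poly_roots_finite[OF R0] sub] card_poly_roots_bound[OF R0] by linarith
  also have "\<dots> \<le> (degree p - 1) * (degree q - 1)"
    unfolding R_def using degree_resultant_le[OF degree_coeff_diff_quot degree_coeff_diff_quot]
    by (metis degree_diff_quot)
  also have "\<dots> \<le> (degree p - 1) * (degree p - 2)"
    using deg by (intro mult_le_mono) auto
  finally show "card T \<le> (degree p - 1) * (degree p - 2)" .
qed

section \<open>Every zero of the curve equation lies on the image\<close>

lemma poly_map_poly_eval: "poly (map_poly (\<lambda>c. poly c x) P) y = poly2 P x y"
  for P :: "'a::comm_ring_1 poly poly"
  unfolding poly2_def using poly_hom.poly_map_poly[of x P "[:y:]"] by simp

text \<open>Both sides have the same top coefficient and agree at as many points as the degree, so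
  they coincide.\<close>

lemma eq_prod_roots:
  fixes f :: "'a::idom poly"
  assumes "f \<noteq> 0" and card: "card {z. poly f z = 0} = degree f"
  shows "f = smult (lead_coeff f) (\<Prod>z | poly f z = 0. [:- z, 1:])"
proof (rule poly_eqI_degree_lead_coeff)
  let ?R = "{z. poly f z = 0}"
  have fin: "finite ?R" using \<open>f \<noteq> 0\<close> by (rule poly_roots_finite)
  have deg: "degree (\<Prod>z\<in>?R. [:- z, 1:]) = degree f"
    by (subst degree_prod_sum_eq) (simp_all add: card)
  have "lead_coeff (\<Prod>z\<in>?R. [:- z, 1:]) = 1"
    by (simp add: lead_coeff_prod)
  then show "coeff f (degree f) = coeff (smult (lead_coeff f) (\<Prod>z\<in>?R. [:- z, 1:])) (degree f)"
    unfolding deg by (simp del: one_poly_eq_simps)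
  show "degree (smult (lead_coeff f) (\<Prod>z\<in>?R. [:- z, 1:])) \<le> degree f"
    using degree_smult_le[of "lead_coeff f" "\<Prod>z\<in>?R. [:- z, 1:]"] deg by simp
  show "degree f \<le> card ?R" using card by simp
  show "poly f z = poly (smult (lead_coeff f) (\<Prod>z\<in>?R. [:- z, 1:])) z" if "z \<in> ?R" for z
  proof -
    have "poly (\<Prod>z\<in>?R. [:- z, 1:]) z = 0"
      unfolding poly_prod using that fin by (intro prod_zero) auto
    then show ?thesis using that by simp
  qed
qed simp

lemma card_roots_rsquarefree:
  fixes f :: "complex poly"
  assumes "rsquarefree f"
  shows "card {z. poly f z = 0} = degree f"
proof -
  have "f \<noteq> 0" using assms by (simp add: rsquarefree_def)
  have "degree f = degree (smult (lead_coeff f) (\<Prod>z | poly f z = 0. [:- z, 1:]))"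
    using complex_poly_decompose_rsquarefree[OF assms] by simp
  also have "\<dots> = degree (\<Prod>z | poly f z = 0. [:- z, 1:])"
    using \<open>f \<noteq> 0\<close> by (intro degree_smult_eq[THEN trans]) simp
  also have "\<dots> = card {z. poly f z = 0}"
    by (subst degree_prod_sum_eq) simp_all
  finally show ?thesis by simp
qed

text \<open>Without a common root, \<open>p - x\<close> and \<open>q - y\<close> satisfy a Bezout
  identity with nonzero constant \<open>c\<close>. As \<open>p\<close> is nonconstant,
  \<open>t\<close> stays bounded while \<open>p t\<close> is near \<open>x\<close>; the cofactors
  are then bounded, and both differences cannot be small at once.\<close>

lemma common_root_or_far:
  fixes p q :: "complex poly"
  assumes "degree p > 0" and "\<And>t. poly p t = x \<Longrightarrow> poly q t \<noteq> y"
  obtains \<delta> where "\<delta> > 0"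
    "\<And>t. dist (poly p t) x < \<delta> \<Longrightarrow> \<delta> \<le> dist (poly q t) y"
proof -
  let ?p = "p - [:x:]" and ?q = "q - [:y:]"
  define g where "g = gcd ?p ?q"
  have "?p \<noteq> 0" using assms(1) by auto
  then have "g \<noteq> 0" by (simp add: g_def)
  have "degree g = 0"
  proof (rule ccontr)
    assume "degree g \<noteq> 0"
    then obtain t where "poly g t = 0" using alg_closed_imp_poly_has_root by blast
    then have "poly ?p t = 0" "poly ?q t = 0"
      unfolding g_def by (auto simp: poly_eq_0_iff_dvd simp del: poly_diff)
    then show False using assms(2)[of t] by simp
  qed
  with \<open>g \<noteq> 0\<close> obtain c where c: "g = [:c:]" "c \<noteq> 0"
    by (metis degree_eq_zeroE pCons_0_0)
  define A C where "A = fst (bezout_coefficients ?p ?q)" and "C = snd (bezout_coefficients ?p ?q)"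
  have bezout: "A * ?p + C * ?q = [:c:]"
    unfolding A_def C_def c(1)[symmetric] g_def by (rule bezout_coefficients_fst_snd)
  have AC: "poly A t * (poly p t - x) + poly C t * (poly q t - y) = c" for t
    using arg_cong[OF bezout, of "\<lambda>f. poly f t"] by simp
  obtain a p' where p': "p = pCons a p'" "p' \<noteq> 0"
    using assms(1) by (metis degree_pCons_0 less_numeral_extra(3) pCons_cases)
  obtain r where r: "\<And>t. r \<le> norm t \<Longrightarrow> norm x + 1 \<le> norm (poly p t)"
    using poly_infinity[OF p'(2)] p'(1) by metis
  obtain K L where "K > 0" and K: "\<And>t. norm t \<le> r \<Longrightarrow> norm (poly A t) \<le> K"
    and L: "\<And>t. norm t \<le> r \<Longrightarrow> norm (poly C t) \<le> L"
    using poly_bound_exists[of r A] poly_bound_exists[of r C] by metis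
  define M where "M = max K L"
  \<comment> \<open>The bound 1 keeps \<open>t\<close> in the disc of radius \<open>r\<close>; the
    other gives the first Bezout term at most half of \<open>norm c\<close>, leaving the rest to
    \<open>q\<close>.\<close>
  define \<delta> where "\<delta> = min 1 (norm c / (2 * M))"
  have M: "M > 0" using \<open>K > 0\<close> by (simp add: M_def)
  show thesis
  proof (rule that)
    show "\<delta> > 0" using M c(2) by (simp add: \<delta>_def)
    fix t assume t: "dist (poly p t) x < \<delta>"
    have "norm (poly p t) \<le> norm x + dist (poly p t) x"
      using norm_triangle_sub[of "poly p t" x] by (simp add: dist_norm)
    also have "\<dots> < norm x + 1" using t by (simp add: \<delta>_def)
    finally have tr: "norm t \<le> r" using r[of t] by linarith
    have "norm c \<le> norm (poly A t) * dist (poly p t) x + norm (poly C t) * dist (poly q t) y"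
      unfolding AC[of t, symmetric] dist_norm
      using norm_triangle_ineq[of "poly A t * (poly p t - x)" "poly C t * (poly q t - y)"]
      by (simp add: norm_mult)
    also have "\<dots> \<le> M * dist (poly p t) x + M * dist (poly q t) y"
      using K[OF tr] L[OF tr] by (intro add_mono mult_right_mono) (auto simp: M_def)
    finally have "norm c \<le> M * dist (poly p t) x + M * dist (poly q t) y" .
    moreover have "M * dist (poly p t) x \<le> M * \<delta>" "M * \<delta> \<le> norm c / 2"
      using t M by (auto simp: \<delta>_def min_def field_simps)
    ultimately have "M * \<delta> \<le> M * dist (poly q t) y" by linarith
    then show "\<delta> \<le> dist (poly q t) y" using M by simp
  qed
qed

text \<open>Over a general \<open>x\<close> the parametrisation provides \<open>degree p\<close> distinct zeros, so \<open>P\<close> has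
  \<open>y\<close>-degree \<open>degree p\<close> and constant leading coefficient in \<open>y\<close>, and those are all the
  zeros over \<open>x\<close>.  A zero off the image would be far away from them as \<open>x\<close> approaches
  its abscissa.\<close>

lemma zeros_subset_param:
  fixes P :: "complex poly poly" and p q :: "complex poly"
  assumes "P \<noteq> 0" and dp: "degree p > 0"
    and total: "\<And>j. coeff P j \<noteq> 0 \<Longrightarrow> degree (coeff P j) + j \<le> degree p"
    and on: "\<And>t. poly2 P (poly p t) (poly q t) = 0"
    and E: "finite E" "\<And>s t. t \<notin> E \<Longrightarrow> poly p s = poly p t \<Longrightarrow> poly q s = poly q t \<Longrightarrow> s = t"
    and zero: "poly2 P x0 y0 = 0"
  shows "\<exists>t. poly p t = x0 \<and> poly q t = y0"
proof (rule ccontr)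
  assume "\<not> (\<exists>t. poly p t = x0 \<and> poly q t = y0)"
  then obtain \<delta> where \<delta>: "\<delta> > 0"
    "\<And>t. dist (poly p t) x0 < \<delta> \<Longrightarrow> \<delta> \<le> dist (poly q t) y0"
    using common_root_or_far[OF dp, of x0 q y0] by metis
  define F where "F x = map_poly (\<lambda>c. poly c x) P" for x
  define l where "l = lead_coeff P"
  \<comment> \<open>Outside \<open>X\<close> the fibre of \<open>p\<close> has
    \<open>degree p\<close> simple points, \<open>q\<close> separates them, and \<open>F x\<close>
    keeps its leading coefficient.\<close>
  define X where "X = poly p ` E \<union> poly p ` {t. poly (pderiv p) t = 0} \<union> {x. poly l x = 0}"
  have l0: "l \<noteq> 0" using \<open>P \<noteq> 0\<close> by (simp add: l_def)
  have "pderiv p \<noteq> 0" using dp by (simp add: pderiv_eq_0_iff)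
  then have finX: "finite X"
    using E(1) l0 by (auto simp: X_def poly_roots_finite)
  have lF: "coeff (F x) (degree P) = poly l x" for x
    by (simp add: F_def l_def coeff_map_poly)
  have dF: "degree (F x) \<le> degree P" for x
    by (simp add: F_def degree_map_poly_le)
  have fibre: "card (poly q ` {t. poly p t = x}) = degree p \<and>
      poly q ` {t. poly p t = x} \<subseteq> {y. poly (F x) y = 0} \<and> F x \<noteq> 0" if "x \<notin> X" for x
  proof -
    have "rsquarefree (p - [:x:])"
      using that by (auto simp: rsquarefree_roots X_def pderiv_diff pderiv_pCons)
    then have "card {t. poly (p - [:x:]) t = 0} = degree (p - [:x:])"
      by (rule card_roots_rsquarefree)
    moreover have "degree (p - [:x:]) = degree p"
      using dp degree_add_eq_left[of "- [:x:]" p] by (simp del: minus_pCons)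
    moreover have "inj_on (poly q) {t. poly p t = x}"
    proof (rule inj_onI)
      fix s t assume "s \<in> {t. poly p t = x}" "t \<in> {t. poly p t = x}" "poly q s = poly q t"
      moreover have "x \<notin> poly p ` E" using that by (simp add: X_def)
      then have "t \<notin> E" using \<open>t \<in> {t. poly p t = x}\<close> by blast
      ultimately show "s = t" using E(2)[of t s] by simp
    qed
    moreover have "F x \<noteq> 0" using lF[of x] that by (auto simp: X_def)
    ultimately show ?thesis
      using on by (auto simp: card_image F_def poly_map_poly_eval)
  qed
  obtain x1 where "x1 \<notin> X" using finX infinite_UNIV_char_0 ex_new_if_finite by blast
  have "degree p \<le> card {y. poly (F x1) y = 0}"
    using fibre[OF \<open>x1 \<notin> X\<close>] poly_roots_finite card_mono by metis
  also have "\<dots> \<le> degree P"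
    using card_poly_roots_bound[of "F x1"] fibre[OF \<open>x1 \<notin> X\<close>] dF[of x1] by linarith
  finally have degP: "degree P = degree p" and "degree l = 0"
    using total[of "degree P"] l0 by (auto simp: l_def)
  then obtain c where c: "l = [:c:]" "c \<noteq> 0"
    using l0 by (metis degree_eq_zeroE pCons_0_0)
  \<comment> \<open>Here \<open>F x\<close> splits as \<open>c\<close> times the product of
    \<open>y - q t\<close> over the fibre, and by the choice of \<open>\<delta>\<close> each factor
    at \<open>y0\<close> has modulus at least \<open>\<delta>\<close>.\<close>
  have far: "norm c * \<delta> ^ degree p \<le> norm (poly2 P x y0)" if "x \<notin> X" "dist x x0 < \<delta>" for x
  proof -
    have coeff: "coeff (F x) (degree p) = c" using lF[of x] c(1) degP by simp
    then have "degree p \<le> degree (F x)" using c(2) by (intro le_degree) simp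
    then have Fx: "degree (F x) = degree p" using dF[of x] degP by simp
    have roots: "{y. poly (F x) y = 0} = poly q ` {t. poly p t = x}"
      using fibre[OF that(1)] Fx card_poly_roots_bound[of "F x"]
      by (intro card_seteq[symmetric]) (auto intro: poly_roots_finite)
    have "poly (F x) y0 = c * (\<Prod>y\<in>poly q ` {t. poly p t = x}. y0 - y)"
      using arg_cong[OF eq_prod_roots[of "F x"], of "\<lambda>f. poly f y0"] fibre[OF that(1)] Fx
      by (simp add: roots poly_prod coeff)
    then have "norm (poly2 P x y0) = norm c * (\<Prod>y\<in>poly q ` {t. poly p t = x}. dist y y0)"
      by (simp add: F_def poly_map_poly_eval norm_mult dist_norm norm_minus_commute[of _ y0]
          flip: prod_norm)
    moreover have "(\<Prod>y\<in>poly q ` {t. poly p t = x}. \<delta>) \<le> (\<Prod>y\<in>poly q ` {t. poly p t = x}. dist y y0)"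
      using \<delta> that(2) by (intro prod_mono) auto
    ultimately show ?thesis
      using fibre[OF that(1)] by (simp add: mult_left_mono)
  qed
  have "((\<lambda>x. norm (poly2 P x y0)) \<longlongrightarrow> 0) (at x0)"
    using zero unfolding poly2_def by (intro tendsto_eq_intros) auto
  then have "\<forall>\<^sub>F x in at x0. norm (poly2 P x y0) < norm c * \<delta> ^ degree p"
    using c(2) \<delta>(1) by (intro order_tendstoD) auto
  moreover have "\<forall>\<^sub>F x in at x0. dist x x0 < \<delta>"
    using \<delta>(1) by (auto simp: eventually_at)
  \<comment> \<open>The abscissa \<open>x0\<close> may itself belong to \<open>X\<close>; the
    punctured filter leaves it out.\<close>
  moreover have "\<forall>\<^sub>F x in at x0. x \<notin> X"
    using finX open_Compl[OF finite_imp_closed[of "X - {x0}"]]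
    by (auto simp: eventually_at_topological intro!: exI[of _ "- (X - {x0})"])
  ultimately have "\<forall>\<^sub>F x in at x0. False"
    by eventually_elim (use far in force)
  then show False by simp
qed

section \<open>Parameters of integer points\<close>

lemma coeff_pCons_1_power:
  fixes a :: "'a::comm_semiring_1"
  shows "i \<le> n \<Longrightarrow> coeff (pCons a 1 ^ n) i = of_nat (n choose i) * a ^ (n - i)"
  using coeff_linear_poly_power[of i n a 1] by simp

text \<open>The gcd over \<open>\<rat>\<close> is a power of \<open>X - t\<close> up to a constant, and its second coefficient
  reveals \<open>t\<close>.\<close>

lemma unique_common_root_rational:
  fixes f g :: "rat poly" and t :: complex
  assumes "f \<noteq> 0"
    and root: "poly (map_poly of_rat f) t = 0" "poly (map_poly of_rat g) t = 0"
    and unique: "\<And>s. poly (map_poly of_rat f) s = 0 \<Longrightarrow> poly (map_poly of_rat g) s = 0 \<Longrightarrow> s = t"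
  shows "\<exists>r. t = of_rat r"
proof -
  interpret field_hom' "of_rat :: rat \<Rightarrow> complex" ..
  define h where "h = gcd f g"
  define hc :: "complex poly" where "hc = map_poly of_rat h"
  define n where "n = order t hc"
  have "hc \<noteq> 0" using \<open>f \<noteq> 0\<close> by (simp add: hc_def h_def)
  \<comment> \<open>Gcds are preserved by field extension, so the complex roots of \<open>h\<close>
    are exactly the common roots of \<open>f\<close> and \<open>g\<close>.\<close>
  have hc_gcd: "hc = gcd (map_poly of_rat f) (map_poly of_rat g)"
    unfolding hc_def h_def by (rule map_poly_gcd)
  have "poly hc s = 0 \<longleftrightarrow> poly (map_poly of_rat f) s = 0 \<and> poly (map_poly of_rat g) s = 0" for s
    unfolding hc_gcd poly_eq_0_iff_dvd by (rule gcd_greatest_iff)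
  then have roots: "{s. poly hc s = 0} = {t}"
    using root unique by blast
  then have "n > 0"
    unfolding n_def using \<open>hc \<noteq> 0\<close> order_root[of hc t] by auto
  have "smult (lead_coeff hc) (\<Prod>s | poly hc s = 0. [:- s, 1:] ^ order s hc) = hc"
    by (rule complex_poly_decompose)
  then have hc: "hc = smult (lead_coeff hc) ([:- t, 1:] ^ n)"
    unfolding roots by (simp add: n_def)
  have "coeff hc (n - 1) = lead_coeff hc * (of_nat n * - t)"
    using arg_cong[OF hc, of "\<lambda>f. coeff f (n - 1)"] binomial_symmetric[of "n - 1" n] \<open>n > 0\<close>
    by (simp add: coeff_pCons_1_power)
  then have "t = - coeff hc (n - 1) / (lead_coeff hc * of_nat n)"
    using \<open>hc \<noteq> 0\<close> \<open>n > 0\<close> by (simp add: field_simps)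
  also have "\<dots> = of_rat (- coeff h (n - 1) / (lead_coeff h * of_nat n))"
    by (simp add: hc_def of_rat_minus of_rat_divide of_rat_mult)
  finally show ?thesis by blast
qed

text \<open>The fibres of \<open>f\<close> over \<open>Z\<close> are disjoint and each has two
  elements in \<open>T\<close>. This is where the factor 1/2 in the double point term comes
  from.\<close>

lemma two_card_le:
  assumes "finite T" and two: "\<And>z. z \<in> Z \<Longrightarrow> \<exists>s\<in>T. \<exists>t\<in>T. s \<noteq> t \<and> f s = z \<and> f t = z"
  shows "finite Z" and "2 * card Z \<le> card T"
proof -
  have "Z \<subseteq> f ` T" using two by blast
  then show fin: "finite Z" using \<open>finite T\<close> finite_surj by blast
  have "2 \<le> card {t \<in> T. f t = z}" if "z \<in> Z" for z
  proof -
    obtain s t where "s \<in> T" "t \<in> T" "s \<noteq> t" "f s = z" "f t = z" using two \<open>z \<in> Z\<close> by blast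
    then have "card {s, t} \<le> card {t \<in> T. f t = z}"
      using \<open>finite T\<close> by (intro card_mono) auto
    then show ?thesis using \<open>s \<noteq> t\<close> by simp
  qed
  then have "2 * card Z \<le> (\<Sum>z\<in>Z. card {t \<in> T. f t = z})"
    using sum_mono[of Z "\<lambda>_. 2::nat" "\<lambda>z. card {t \<in> T. f t = z}"] by simp
  also have "\<dots> = card (\<Union>z\<in>Z. {t \<in> T. f t = z})"
    using fin \<open>finite T\<close> by (intro card_UN_disjoint[symmetric]) auto
  also have "\<dots> \<le> card T" using \<open>finite T\<close> by (intro card_mono) auto
  finally show "2 * card Z \<le> card T" .
qed

text \<open>The rational root argument: for \<open>r = m / n\<close> in lowest terms, clearing
  denominators makes \<open>n\<close> divide \<open>a d * m ^ d\<close>, hence \<open>a d\<close>.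
  The right-hand side becomes \<open>x * n ^ d\<close>, a multiple of \<open>n\<close> since
  \<open>d > 0\<close>.\<close>

lemma rational_point_denominator:
  fixes a :: "nat \<Rightarrow> int" and b x :: int and r :: rat
  assumes "a d \<noteq> 0" "d > 0"
    and eq: "(\<Sum>i\<le>d. of_int (a i) * r ^ i) = of_int x"
  shows "\<exists>k::int. r = of_int k / of_int (a d)"
proof -
  obtain m n :: int where r: "r = of_int m / of_int n" "n > 0" "coprime m n"
    by (cases r) (simp add: Fract_of_int_quotient)
  have "of_int (\<Sum>i\<le>d. a i * m ^ i * n ^ (d - i)) = (\<Sum>i\<le>d. of_int (a i) * r ^ i) * of_int n ^ d"
    unfolding of_int_sum sum_distrib_right
  proof (intro sum.cong refl)
    fix i assume "i \<in> {..d}"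
    then have "of_int n ^ d = (of_int n ^ i * of_int n ^ (d - i) :: rat)"
      by (simp flip: power_add)
    then show "of_int (a i * m ^ i * n ^ (d - i)) = of_int (a i) * r ^ i * of_int n ^ d"
      using r(2) by (simp add: r(1) power_divide)
  qed
  also have "\<dots> = of_int (x * n ^ d)" by (simp add: eq)
  finally have "(\<Sum>i\<le>d. a i * m ^ i * n ^ (d - i)) = x * n ^ d"
    by (simp only: of_int_eq_iff)
  then have "a d * m ^ d = x * n ^ d - (\<Sum>i<d. a i * m ^ i * n ^ (d - i))"
    by (simp add: lessThan_Suc_atMost[symmetric])
  also have "n dvd \<dots>"
    using \<open>d > 0\<close> by (intro dvd_diff dvd_sum dvd_mult) (auto intro: dvd_power)
  finally have "n dvd a d"
    using r(3) by (simp add: coprime_dvd_mult_left_iff coprime_commute)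
  then obtain e where "a d = n * e" ..
  then have "r = of_int (m * e) / of_int (a d)"
    using \<open>a d \<noteq> 0\<close> by (simp add: r(1))
  then show ?thesis by blast
qed

section \<open>Integers in a sublevel set\<close>

text \<open>The summand 1 in this count is the one in the final bound.\<close>

lemma card_int_interval_le:
  fixes c u \<rho> :: real
  assumes "c > 0" "\<rho> \<ge> 0" and S: "\<And>k. k \<in> S \<Longrightarrow> \<bar>of_int k / c - u\<bar> \<le> \<rho>"
  shows "finite S" and "real (card S) \<le> 2 * c * \<rho> + 1"
proof -
  let ?I = "{\<lceil>c * (u - \<rho>)\<rceil>..\<lfloor>c * (u + \<rho>)\<rfloor>}"
  have "S \<subseteq> ?I"
  proof
    fix k assume "k \<in> S"
    then have "u - \<rho> \<le> of_int k / c" "of_int k / c \<le> u + \<rho>" using S[of k] by auto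
    then have "c * (u - \<rho>) \<le> of_int k" "of_int k \<le> c * (u + \<rho>)"
      using \<open>c > 0\<close> by (simp_all add: pos_le_divide_eq pos_divide_le_eq mult.commute)
    then show "k \<in> ?I" by (simp add: ceiling_le_iff le_floor_iff)
  qed
  then show "finite S" by (rule finite_subset) simp
  have "real_of_int \<lfloor>c * (u + \<rho>)\<rfloor> \<le> c * (u + \<rho>)" "c * (u - \<rho>) \<le> real_of_int \<lceil>c * (u - \<rho>)\<rceil>"
    by (rule of_int_floor_le, rule le_of_int_ceiling)
  then have "real_of_int (\<lfloor>c * (u + \<rho>)\<rfloor> + 1 - \<lceil>c * (u - \<rho>)\<rceil>) \<le> c * (u + \<rho>) + 1 - c * (u - \<rho>)"
    unfolding of_int_diff of_int_add of_int_1 by linarith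
  also have "\<dots> = 2 * c * \<rho> + 1" by (simp add: algebra_simps)
  finally have "real (card ?I) \<le> 2 * c * \<rho> + 1"
    using assms(1,2) unfolding card_atLeastAtMost_int by (cases "\<lfloor>c * (u + \<rho>)\<rfloor> + 1 < \<lceil>c * (u - \<rho>)\<rceil>") auto
  moreover have "card S \<le> card ?I" using \<open>S \<subseteq> ?I\<close> by (intro card_mono) simp_all
  ultimately show "real (card S) \<le> 2 * c * \<rho> + 1" by linarith
qed

text \<open>After completing the \<open>d\<close>-th power at \<open>u0\<close> the error term has degree at most \<open>d - 2\<close>,
  which moves the ends of the interval by \<open>o(1)\<close> only.\<close>

lemma sublevel_set_interval:
  fixes p :: "real poly" and \<eta> :: real
  defines "d \<equiv> degree p" and "c \<equiv> lead_coeff p"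
  assumes "d > 0" "c > 0" "\<eta> > 0"
  shows "\<exists>u0. \<exists>B0>0. \<forall>B\<ge>B0. \<forall>u. \<bar>poly p u\<bar> \<le> B \<longrightarrow> \<bar>u - u0\<bar> \<le> (B / c) powr (1 / d) + \<eta>"
proof -
  \<comment> \<open>With this centre, \<open>c * (u - u0) ^ d\<close> and \<open>p\<close> agree in
    degree \<open>d - 1\<close> as well as in degree \<open>d\<close>.\<close>
  define u0 where "u0 = - coeff p (d - 1) / (d * c)"
  define w where "w = p - smult c ([:- u0, 1:] ^ d)"
  define K where "K = (\<Sum>i\<le>degree w. \<bar>coeff w i\<bar> * (1 + \<bar>u0\<bar>) ^ i)"
  \<comment> \<open>For \<open>v > M\<close> this yields \<open>K < c * \<eta> * v\<close>, so the
    error is smaller than the gain from the margin \<open>\<eta>\<close>.\<close>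
  define M where "M = max 1 (K / (c * \<eta>))"
  have w0: "coeff w i = 0" if i: "d \<le> Suc i" for i
  proof -
    consider "i > d" | "i = d" | "Suc i = d" using i by linarith
    then show ?thesis
    proof cases
      case 1
      then show ?thesis
        by (simp add: w_def coeff_eq_0 d_def degree_power_eq)
    next
      case 2
      then show ?thesis
        by (simp add: w_def coeff_pCons_1_power d_def c_def)
    next
      case 3
      then have "(d choose i) = d" "i = d - 1" "d - i = 1"
        using binomial_symmetric[of i d] by auto
      then show ?thesis
        using \<open>d > 0\<close> \<open>c > 0\<close>
        by (simp add: w_def coeff_pCons_1_power u0_def)
    qed
  qed
  have K: "K \<ge> 0" unfolding K_def by (intro sum_nonneg) simp
  \<comment> \<open>This is the estimate of order \<open>d - 2\<close> for \<open>w\<close>,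
    multiplied by the distance so that \<open>d = 1\<close>, where \<open>w = 0\<close>, is covered
    too.\<close>
  have w: "\<bar>poly w u\<bar> * \<bar>u - u0\<bar> \<le> K * \<bar>u - u0\<bar> ^ (d - 1)" if v: "\<bar>u - u0\<bar> \<ge> 1" for u
  proof -
    define v where "v = \<bar>u - u0\<bar>"
    have v1: "v \<ge> 1" using v by (simp add: v_def)
    have "\<bar>u0\<bar> * 1 \<le> \<bar>u0\<bar> * v" using v1 by (intro mult_left_mono) auto
    then have u: "\<bar>u\<bar> \<le> (1 + \<bar>u0\<bar>) * v" by (simp add: v_def algebra_simps)
    have "\<bar>coeff w i * u ^ i\<bar> * v \<le> (\<bar>coeff w i\<bar> * (1 + \<bar>u0\<bar>) ^ i) * v ^ (d - 1)" for i
    proof (cases "d \<le> Suc i")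
      case False
      have "\<bar>coeff w i * u ^ i\<bar> * v \<le> \<bar>coeff w i\<bar> * ((1 + \<bar>u0\<bar>) * v) ^ i * v"
        using u v1 by (intro mult_mono) (auto simp: abs_mult power_abs intro!: mult_left_mono power_mono)
      also have "\<dots> = (\<bar>coeff w i\<bar> * (1 + \<bar>u0\<bar>) ^ i) * v ^ Suc i"
        by (simp add: power_mult_distrib)
      also have "\<dots> \<le> (\<bar>coeff w i\<bar> * (1 + \<bar>u0\<bar>) ^ i) * v ^ (d - 1)"
        using False v1 by (intro mult_left_mono power_increasing) auto
      finally show ?thesis .
    qed (simp add: w0)
    then have "(\<Sum>i\<le>degree w. \<bar>coeff w i * u ^ i\<bar>) * v \<le> K * v ^ (d - 1)"
      unfolding K_def sum_distrib_right by (intro sum_mono)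
    moreover have "\<bar>poly w u\<bar> * v \<le> (\<Sum>i\<le>degree w. \<bar>coeff w i * u ^ i\<bar>) * v"
      unfolding poly_altdef using v1 by (intro mult_right_mono sum_abs) auto
    ultimately show ?thesis unfolding v_def by linarith
  qed
  \<comment> \<open>If \<open>v > r + \<eta>\<close>, then \<open>v ^ d\<close> exceeds
    \<open>r ^ d\<close> by at least \<open>\<eta> * v ^ (d - 1)\<close>. Since
    \<open>c * r ^ d = B\<close> and the error is below \<open>c * \<eta> * v ^ (d - 1)\<close>,
    this forces \<open>\<bar>poly p u\<bar> > B\<close>. The threshold on \<open>B\<close> ensures
    \<open>r \<ge> M\<close>.\<close>
  have "\<bar>u - u0\<bar> \<le> (B / c) powr (1 / d) + \<eta>" if B: "B \<ge> c * M ^ d" and u: "\<bar>poly p u\<bar> \<le> B" for B u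
  proof (rule ccontr)
    define r where "r = (B / c) powr (1 / d)"
    define v where "v = \<bar>u - u0\<bar>"
    assume "\<not> \<bar>u - u0\<bar> \<le> (B / c) powr (1 / d) + \<eta>"
    then have v: "v > r + \<eta>" by (simp add: r_def v_def)
    have "M \<ge> 1" by (simp add: M_def)
    then have "M ^ d \<ge> 1" by (rule one_le_power)
    have Bc: "M ^ d \<le> B / c" using B \<open>c > 0\<close> by (simp add: field_simps)
    then have "B / c > 0" using \<open>M ^ d \<ge> 1\<close> by linarith
    then have "r > 0" unfolding r_def by (metis less_irrefl powr_gt_zero)
    then have "r ^ d = r powr d" by (simp add: powr_realpow)
    also have "\<dots> = B / c" using \<open>d > 0\<close> \<open>B / c > 0\<close> unfolding r_def powr_powr
      by (simp del: zero_less_divide_iff abs_divide)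
    finally have rd: "r ^ d = B / c" .
    have "r \<ge> 0" by (simp add: r_def)
    have "r \<ge> M"
    proof (rule ccontr)
      assume "\<not> r \<ge> M"
      then have "r ^ d < M ^ d" using \<open>r \<ge> 0\<close> \<open>d > 0\<close> by (intro power_strict_mono) auto
      then show False using Bc rd by simp
    qed
    then have "v > M" using v \<open>\<eta> > 0\<close> by linarith
    then have v1: "v \<ge> 1" and "K / (c * \<eta>) < v" by (auto simp: M_def)
    then have "K < c * \<eta> * v"
      using \<open>c > 0\<close> \<open>\<eta> > 0\<close> by (simp add: field_simps)
    have dS: "x ^ d = x * x ^ (d - 1)" for x :: real
      using \<open>d > 0\<close> by (metis power_minus_mult mult.commute)
    have "\<bar>poly w u\<bar> * v \<le> K * v ^ (d - 1)" using w[of u] v1 by (simp add: v_def)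
    also have "\<dots> < (c * \<eta> * v) * v ^ (d - 1)"
      using \<open>K < c * \<eta> * v\<close> v1 by (intro mult_strict_right_mono) auto
    finally have "\<bar>poly w u\<bar> * v < (c * \<eta> * v ^ (d - 1)) * v" by (simp add: mult_ac)
    then have wu: "\<bar>poly w u\<bar> < c * \<eta> * v ^ (d - 1)" using v1 by simp
    have "r * r ^ (d - 1) \<le> r * v ^ (d - 1)"
      using v \<open>\<eta> > 0\<close> \<open>r \<ge> 0\<close> by (intro mult_left_mono power_mono) auto
    moreover have "(r + \<eta>) * v ^ (d - 1) \<le> v * v ^ (d - 1)"
      using v v1 by (intro mult_right_mono) auto
    ultimately have "r ^ d + \<eta> * v ^ (d - 1) \<le> v ^ d"
      unfolding dS by (simp add: algebra_simps)
    then have "c * r ^ d + c * \<eta> * v ^ (d - 1) \<le> c * v ^ d"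
      using mult_left_mono[of _ _ c] \<open>c > 0\<close> by (fastforce simp: algebra_simps)
    moreover have "c * r ^ d = B" using rd \<open>c > 0\<close> by simp
    moreover have "poly p u = poly w u + c * (u - u0) ^ d"
      by (simp add: w_def)
    moreover have "\<bar>c * (u - u0) ^ d\<bar> = c * v ^ d"
      using \<open>c > 0\<close> by (simp add: v_def power_abs abs_mult)
    ultimately show False using u wu by linarith
  qed
  moreover have "c * M ^ d > 0" using \<open>c > 0\<close> by (simp add: M_def)
  ultimately show ?thesis by blast
qed

section \<open>Image and double parameters of the given parametrisation\<close>

lemma le_total_degree:
  assumes "coeff (coeff P j) i \<noteq> 0"
  shows "i + j \<le> total_degree P"
proof -
  have "{i + j |i j. coeff (coeff P j) i \<noteq> 0}
      \<subseteq> (\<lambda>(j, i). i + j) ` (SIGMA j:{..degree P}. {..degree (coeff P j)})"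
    by (fastforce simp: image_def intro: le_degree dest: coeff_eq_0)
  then have "finite {i + j |i j. coeff (coeff P j) i \<noteq> 0}"
    by (rule finite_subset) simp
  then show ?thesis
    unfolding total_degree_def using assms by (intro Max_ge) auto
qed

text \<open>In total degree 0 the polynomial would be a constant, hence zero or a unit. This
  supplies \<open>d > 0\<close>.\<close>

lemma irreducible_imp_total_degree_pos:
  fixes P :: "'a::field poly poly"
  assumes "irreducible P"
  shows "total_degree P > 0"
proof (rule ccontr)
  assume "\<not> total_degree P > 0"
  then have 0: "coeff (coeff P j) i = 0" if "i + j > 0" for i j
    using le_total_degree[of P j i] that by linarith
  have "P = [:[:coeff (coeff P 0) 0:]:]"
    by (intro poly_eqI) (auto simp: coeff_pCons 0 split: nat.splits)
  moreover have "P \<noteq> 0" using assms by auto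
  ultimately obtain c where "P = [:[:c:]:]" "c \<noteq> 0" by (metis pCons_0_0)
  then have "is_unit P"
    by (simp add: is_unit_pCons_iff)
  then show False using assms by (simp add: irreducible_not_unit)
qed

abbreviation cpoly :: "rat poly \<Rightarrow> complex poly" where
  "cpoly \<equiv> map_poly of_rat"

lemma poly_cpoly_of_rat: "poly (cpoly p) (of_rat r) = of_rat (poly p r)"
  by (rule of_rat_hom.poly_map_poly)

text \<open>The inverse \<open>G / H\<close> recovers \<open>t\<close> from its image unless
  \<open>H\<close> vanishes there. That condition depends on the image alone, so excluding
  \<open>t\<close> also excludes every \<open>s\<close> with the same image.\<close>

lemma parametrisation_injective:
  assumes "polynomial_parametrisation p q C"
  obtains E where "finite E" "\<And>s t. t \<notin> E \<Longrightarrow> poly (cpoly p) s = poly (cpoly p) t \<Longrightarrow>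
    poly (cpoly q) s = poly (cpoly q) t \<Longrightarrow> s = t"
proof -
  obtain G H :: "complex poly poly" where
    fin: "finite {t. poly2 H (fst (param_map p q t)) (snd (param_map p q t)) = 0}" and
    inv: "\<And>t. poly2 H (fst (param_map p q t)) (snd (param_map p q t)) \<noteq> 0 \<Longrightarrow>
      rat_fun2 G H (param_map p q t) = t"
    using assms unfolding polynomial_parametrisation_def by blast
  show thesis
  proof (rule that[OF fin])
    fix s t
    assume t: "t \<notin> {t. poly2 H (fst (param_map p q t)) (snd (param_map p q t)) = 0}"
      and "poly (cpoly p) s = poly (cpoly p) t" "poly (cpoly q) s = poly (cpoly q) t"
    then have "param_map p q s = param_map p q t" by (simp add: param_map_def)
    then show "s = t" using inv[of s] inv[of t] t by simp
  qed
qed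

text \<open>The equality of degrees becomes the bound on the coefficients in
  \<open>zeros_subset_param\<close>.\<close>

lemma plane_curve_subset_range:
  assumes "irreducible P"
    and param: "polynomial_parametrisation p q (plane_curve P)"
    and deg: "total_degree P = degree p"
  shows "plane_curve P \<subseteq> range (param_map p q)"
proof -
  define Q :: "complex poly poly" where "Q = map_poly cpoly P"
  have coeffQ: "coeff Q j = cpoly (coeff P j)" for j
    by (simp add: Q_def coeff_map_poly)
  have "P \<noteq> 0" using assms(1) by auto
  then have "Q \<noteq> 0" by (simp add: Q_def map_poly_eq_0_iff)
  have dp: "degree p > 0"
    using irreducible_imp_total_degree_pos[OF assms(1)] deg by simp
  have total: "degree (coeff Q j) + j \<le> degree (cpoly p)" if "coeff Q j \<noteq> 0" for j
  proof -
    have "coeff P j \<noteq> 0" using that coeffQ[of j] by auto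
    then have "degree (coeff P j) + j \<le> total_degree P" by (intro le_total_degree) simp
    then show ?thesis by (simp add: coeffQ deg)
  qed
  obtain E where E: "finite E" "\<And>s t. t \<notin> E \<Longrightarrow> poly (cpoly p) s = poly (cpoly p) t \<Longrightarrow>
    poly (cpoly q) s = poly (cpoly q) t \<Longrightarrow> s = t"
    using parametrisation_injective[OF param] by blast
  have "param_map p q t \<in> plane_curve P" for t
    using param unfolding polynomial_parametrisation_def by blast
  then have on: "poly2 Q (poly (cpoly p) t) (poly (cpoly q) t) = 0" for t
    by (simp add: param_map_def plane_curve_def Q_def)
  have "\<exists>t. poly (cpoly p) t = x \<and> poly (cpoly q) t = y" if "poly2 Q x y = 0" for x y
  proof (rule zeros_subset_param[of Q "cpoly p" "cpoly q" E])
    show "degree (cpoly p) > 0" using dp by simp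
  qed (fact \<open>Q \<noteq> 0\<close> total on E that)+
  then show ?thesis
    unfolding plane_curve_def param_map_def Q_def by fastforce
qed

definition double_parameters :: "rat poly \<Rightarrow> rat poly \<Rightarrow> complex set" where
  "double_parameters p q =
    {t. \<exists>s. s \<noteq> t \<and> poly (cpoly p) s = poly (cpoly p) t \<and> poly (cpoly q) s = poly (cpoly q) t}"

text \<open>Subtracting a multiple of \<open>p\<close> from \<open>q\<close> reduces this to \<open>degree q < degree p\<close>.\<close>

lemma double_parameters_bound:
  assumes param: "polynomial_parametrisation p q C"
    and "degree q \<le> degree p" "degree p > 0"
  shows "finite (double_parameters p q)"
    and "card (double_parameters p q) \<le> (degree p - 1) * (degree p - 2)"
proof -
  let ?p = "cpoly p"
  define d where "d = degree p"
  \<comment> \<open>Taking the coefficient at \<open>d\<close>, not the leading one, gives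
    \<open>c = 0\<close> when \<open>degree q < d\<close>.\<close>
  define c where "c = coeff (cpoly q) d / lead_coeff ?p"
  define q' where "q' = cpoly q - smult c ?p"
  have "?p \<noteq> 0" using \<open>degree p > 0\<close> by auto
  have "degree q' < degree ?p"
  proof (intro degree_lessI allI impI)
    fix k assume k: "k \<ge> degree ?p"
    show "coeff q' k = 0"
    proof (cases "k = degree ?p")
      case True
      then show ?thesis using \<open>?p \<noteq> 0\<close> by (simp add: q'_def c_def d_def)
    next
      case False
      then have "coeff p k = 0" "coeff q k = 0"
        using k assms(2) by (auto intro: coeff_eq_0)
      then show ?thesis by (simp add: q'_def)
    qed
  qed (use assms(3) in auto)
  obtain E where E: "finite E" "\<And>s t. t \<notin> E \<Longrightarrow> poly ?p s = poly ?p t \<Longrightarrow>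
    poly (cpoly q) s = poly (cpoly q) t \<Longrightarrow> s = t"
    using parametrisation_injective[OF param] by blast
  have "pderiv ?p \<noteq> 0" using assms(3) by (simp add: pderiv_eq_0_iff)
  then have "finite (E \<union> {t. poly (pderiv ?p) t = 0})"
    using E(1) poly_roots_finite by blast
  then obtain t0 where t0: "t0 \<notin> E" "poly (pderiv ?p) t0 \<noteq> 0"
    using ex_new_if_finite[OF infinite_UNIV_char_0[where 'a = complex]] by blast
  have "s = t0" if "poly ?p s = poly ?p t0" "poly q' s = poly q' t0" for s
    using E(2)[OF t0(1)] that by (simp add: q'_def)
  note T = card_double_points_le[OF \<open>degree q' < degree ?p\<close> t0(2) this]
  have eq: "double_parameters p q =
      {t. \<exists>s. s \<noteq> t \<and> poly ?p s = poly ?p t \<and> poly q' s = poly q' t}"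
    unfolding double_parameters_def by (auto simp: q'_def)
  show "finite (double_parameters p q)" unfolding eq by (rule T(1))
  show "card (double_parameters p q) \<le> (degree p - 1) * (degree p - 2)"
    unfolding eq using T(2) by simp
qed

text \<open>A sole parameter of such a point would be the only common root of \<open>p - x\<close>
  and \<open>q - y\<close>, hence rational. So each point uses up at least two double
  parameters.\<close>

lemma irrational_points_bound:
  assumes param: "polynomial_parametrisation p q C" and "C \<subseteq> range (param_map p q)"
    and "degree q \<le> degree p" "degree p > 0"
  defines "Z \<equiv> {(x :: int, y :: int). (of_int x, of_int y) \<in> C \<and>
    \<not> (\<exists>r. poly p r = of_int x \<and> poly q r = of_int y)}"
  shows "finite Z" and "2 * card Z \<le> (degree p - 1) * (degree p - 2)"
proof -
  let ?T = "double_parameters p q" and ?i = "map_prod of_int of_int :: int \<times> int \<Rightarrow> complex \<times> complex"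
  have two: "\<exists>s\<in>?T. \<exists>t\<in>?T. s \<noteq> t \<and> param_map p q s = z \<and> param_map p q t = z" if z: "z \<in> ?i ` Z" for z
  proof -
    obtain x y :: int where xy: "z = (of_int x, of_int y)" "z \<in> C"
      and irr: "\<not> (\<exists>r. poly p r = of_int x \<and> poly q r = of_int y)"
      using z by (auto simp: Z_def)
    obtain t where t: "z = param_map p q t" using xy(2) assms(2) by blast
    let ?f = "p - [:of_int x:]" and ?g = "q - [:of_int y:]"
    have shift: "cpoly (h - [:of_int n:]) = cpoly h - [:of_int n:]" for h n
      by (intro poly_eqI) (simp add: coeff_map_poly of_rat_diff coeff_pCons split: nat.split)
    have f: "poly (cpoly ?f) s = 0 \<longleftrightarrow> poly (cpoly p) s = of_int x"
      and g: "poly (cpoly ?g) s = 0 \<longleftrightarrow> poly (cpoly q) s = of_int y" for s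
      unfolding shift by simp_all
    have pq: "poly (cpoly p) t = of_int x" "poly (cpoly q) t = of_int y"
      using t xy(1) by (auto simp: param_map_def)
    have "?f \<noteq> 0" using assms(4) by auto
    have "\<exists>s. poly (cpoly ?f) s = 0 \<and> poly (cpoly ?g) s = 0 \<and> s \<noteq> t"
    proof (rule ccontr)
      assume "\<not> ?thesis"
      then obtain r where "t = of_rat r"
        using unique_common_root_rational[OF \<open>?f \<noteq> 0\<close>, of t ?g] pq f g by blast
      then have "poly p r = of_int x \<and> poly q r = of_int y"
        using pq unfolding \<open>t = of_rat r\<close> poly_cpoly_of_rat
        by (metis of_rat_of_int_eq of_rat_eq_iff)
      then show False using irr by blast
    qed
    then obtain s where "poly (cpoly p) s = of_int x" "poly (cpoly q) s = of_int y" "s \<noteq> t"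
      using f g by blast
    then have st: "poly (cpoly p) s = poly (cpoly p) t" "poly (cpoly q) s = poly (cpoly q) t"
      using pq by simp_all
    then have "s \<in> ?T" "t \<in> ?T"
      unfolding double_parameters_def mem_Collect_eq using \<open>s \<noteq> t\<close> by metis+
    moreover have "param_map p q s = z" using st by (simp add: t param_map_def)
    ultimately show ?thesis using t[symmetric] \<open>s \<noteq> t\<close> by (intro bexI conjI)
  qed
  have inj: "inj_on ?i Z" by (auto simp: inj_on_def)
  note T = double_parameters_bound[OF param assms(3,4)]
  note Z = two_card_le[of ?T "?i ` Z", OF T(1) two]
  show "finite Z" using Z(1) inj by (rule finite_imageD)
  show "2 * card Z \<le> (degree p - 1) * (degree p - 2)"
    using Z(2) T(2) card_image[OF inj] by simp
qed

section \<open>Adding up the points with and without a rational parameter\<close>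

theorem lemma15:
  fixes P :: "rat poly poly" and p q :: "rat poly" and d :: nat
    and a :: "nat \<Rightarrow> int" and b :: int
  assumes "irreducible P"
    and "polynomial_parametrisation p q (plane_curve P)"
    and "total_degree P = max (degree p) (degree q)"
    and "max (degree p) (degree q) = degree p"
    and "degree p = d"
    and "p = smult (1 / of_int b) (\<Sum>i\<le>d. monom (of_int (a i)) i)"
    and "Gcd (insert b (a ` {..d})) = 1"
    and "a d > 0"
    and "b > 0"
  shows "\<forall>\<epsilon>::real>0. \<exists>B0::real>0. \<forall>B::real\<ge>B0.
    real (num_integer_points (plane_curve P) B) \<le>
      2 * real_of_int (a d) powr (1 - 1 / real d) * real_of_int b powr (1 / real d) * B powr (1 / real d)
      + (real d - 1) * (real d - 2) / 2 + 1 + \<epsilon>"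
proof (intro allI impI)
  fix \<epsilon> :: real assume "\<epsilon> > 0"
  let ?C = "plane_curve P" and ?A = "real_of_int (a d)" and ?b = "real_of_int b"
  define pr :: "real poly" where "pr = map_poly of_rat p"
  define Z where "Z = {(x :: int, y :: int). (of_int x, of_int y) \<in> ?C \<and>
    \<not> (\<exists>r. poly p r = of_int x \<and> poly q r = of_int y)}"
  have "d > 0" using irreducible_imp_total_degree_pos[OF assms(1)] assms(3-5) by simp
  have on_image: "?C \<subseteq> range (param_map p q)"
    using assms by (intro plane_curve_subset_range) auto
  have "degree q \<le> degree p" "degree p > 0" using assms(4,5) \<open>d > 0\<close> by auto
  note Z = irrational_points_bound[OF assms(2) on_image this, folded Z_def, unfolded assms(5)]
  have "real (2 * card Z) \<le> real ((d - 1) * (d - 2))"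
    using Z(2) of_nat_le_iff by blast
  \<comment> \<open>For \<open>d = 1\<close> the natural number \<open>d - 2\<close> is 0 instead of
    -1, but the factor \<open>d - 1\<close> vanishes on both sides.\<close>
  also have "\<dots> = (real d - 1) * (real d - 2)"
    using \<open>d > 0\<close> by (cases "d = 1") (auto simp: of_nat_diff)
  finally have cardZ: "real (card Z) \<le> (real d - 1) * (real d - 2) / 2" by simp
  have dpr: "degree pr = d" by (simp add: pr_def assms(5))
  have "coeff p d = of_int (a d) / of_int b"
    by (subst assms(6)) (simp add: coeff_sum)
  then have lc: "coeff pr d = ?A / ?b"
    by (simp add: pr_def of_rat_divide)
  define c where "c = ?A / ?b"
  have "c > 0" using assms(8,9) by (simp add: c_def)
  \<comment> \<open>The margin \<open>\<epsilon> / (2 * ?A)\<close> turns into exactly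
    \<open>\<epsilon>\<close> when the interval is rescaled to count multiples of
    \<open>1 / ?A\<close>.\<close>
  obtain u0 B1 where "B1 > 0" and B1: "\<And>B u. B \<ge> B1 \<Longrightarrow> \<bar>poly pr u\<bar> \<le> B \<Longrightarrow>
      \<bar>u - u0\<bar> \<le> (B / c) powr (1 / d) + \<epsilon> / (2 * ?A)"
    using sublevel_set_interval[of pr "\<epsilon> / (2 * ?A)"] \<open>d > 0\<close> \<open>c > 0\<close> \<open>\<epsilon> > 0\<close> assms(8)
    by (auto simp: dpr lc c_def)
  have "real (num_integer_points ?C B) \<le> 2 * ?A powr (1 - 1 / d) * ?b powr (1 / d) * B powr (1 / d)
      + (real d - 1) * (real d - 2) / 2 + 1 + \<epsilon>" if "B \<ge> B1" for B
  proof -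
    define N where "N = {(x :: int, y :: int). (of_int x, of_int y) \<in> ?C \<and>
             \<bar>real_of_int x\<bar> \<le> B \<and> \<bar>real_of_int y\<bar> \<le> B}"
    define S where "S = {k :: int. \<bar>poly pr (of_int k / ?A)\<bar> \<le> B}"
    define \<rho> where "\<rho> = (B / c) powr (1 / d) + \<epsilon> / (2 * ?A)"
    define g where "g k = (\<lfloor>poly p (of_int k / of_int (a d))\<rfloor>, \<lfloor>poly q (of_int k / of_int (a d))\<rfloor>)" for k :: int
    have pr: "poly pr (of_int k / ?A) = of_rat (poly p (of_int k / of_int (a d)))" for k
      unfolding pr_def by (simp add: of_rat_divide flip: of_rat_hom.poly_map_poly)
    have S: "finite S" "real (card S) \<le> 2 * ?A * \<rho> + 1"
      using card_int_interval_le[of ?A \<rho> S u0] assms(8) \<open>\<epsilon> > 0\<close> B1[OF that]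
      by (auto simp: S_def \<rho>_def)
    have "N \<subseteq> Z \<union> g ` S"
    proof (rule subsetI, rule ccontr)
      fix z assume "z \<in> N" "z \<notin> Z \<union> g ` S"
      then obtain x y where z: "z = (x, y)" "(of_int x, of_int y) \<in> ?C" "\<bar>real_of_int x\<bar> \<le> B"
        by (auto simp: N_def)
      then obtain r where r: "poly p r = of_int x" "poly q r = of_int y"
        using \<open>z \<notin> Z \<union> g ` S\<close> by (auto simp: Z_def)
      have "(\<Sum>i\<le>d. of_int (a i) * r ^ i) = of_int (b * x)"
        using r(1) assms(9) by (subst (asm) assms(6)) (simp add: poly_sum poly_monom field_simps)
      then obtain k :: int where k: "r = of_int k / of_int (a d)"
        using rational_point_denominator[of a d r] assms(8) \<open>d > 0\<close> by fastforce
      have "poly pr (of_int k / ?A) = of_int x"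
        unfolding pr k[symmetric] r(1) by simp
      then have "k \<in> S" using z(3) by (simp add: S_def)
      moreover have "g k = z"
        unfolding g_def k[symmetric] r z(1) by simp
      ultimately show False using \<open>z \<notin> Z \<union> g ` S\<close> by blast
    qed
    then have "card N \<le> card (Z \<union> g ` S)" using Z(1) S(1) by (intro card_mono) auto
    also have "\<dots> \<le> card Z + card S"
      using card_Un_le[of Z "g ` S"] card_image_le[OF S(1), of g] by linarith
    finally have "real (num_integer_points ?C B) \<le> real (card Z) + (2 * ?A * \<rho> + 1)"
      using S(2) unfolding num_integer_points_def N_def by linarith
    moreover have "B > 0" using that \<open>B1 > 0\<close> by linarith
    then have "?A * (B / c) powr (1 / d) = ?A powr (1 - 1 / d) * ?b powr (1 / d) * B powr (1 / d)"
      using assms(8,9) by (simp add: c_def powr_mult powr_divide powr_diff)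
    then have "2 * ?A * \<rho> = 2 * ?A powr (1 - 1 / d) * ?b powr (1 / d) * B powr (1 / d) + \<epsilon>"
      using assms(8) by (simp add: \<rho>_def algebra_simps)
    ultimately show ?thesis using cardZ by linarith
  qed
  then show "\<exists>B0::real>0. \<forall>B::real\<ge>B0. real (num_integer_points ?C B) \<le>
      2 * ?A powr (1 - 1 / real d) * ?b powr (1 / real d) * B powr (1 / real d)
      + (real d - 1) * (real d - 2) / 2 + 1 + \<epsilon>"
    using \<open>B1 > 0\<close> by blast
qed

end
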